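(* Let $L:\mathbb{R}^n\times\mathbb{R}^m\to\mathbb{R}$ be twice differentiable and $\rho$-weakly convex-weakly concave, and let $\eta>0$ with $\eta>\rho$. Then the saddle envelope $L_\eta$ has a $\max\{\eta,|\eta^{-1}-\rho^{-1}|^{-1}\}$-Lipschitz gradient on $\mathbb{R}^n\times\mathbb{R}^m$.
   Context: A twice differentiable $L$ is $\rho$-weakly convex-weakly concave ($\rho\in\mathbb{R}$) if $\nabla^2_{xx}L(z)\succeq-\rho I$ and $-\nabla^2_{yy}L(z)\succeq-\rho I$ for all $z=(x,y)$. For $\eta>\rho$, the saddle envelope is $L_\eta(x,y)=\min_{u\in\mathbb{R}^n}\max_{v\in\mathbb{R}^m}L(u,v)+\frac{\eta}{2}\|u-x\|^2-\frac{\eta}{2}\|v-y\|^2$. Convention: $|\eta^{-1}-\rho^{-1}|^{-1}$ is read as $|\eta\rho/(\eta-\rho)|$, so it equals $0$ if $\rho=0$. *)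

theory Defs
  imports "HOL-Analysis.Analysis"
begin

definition grad :: "('a::euclidean_space \<Rightarrow> real) \<Rightarrow> 'a \<Rightarrow> 'a"
  where "grad f x = (THE D. GDERIV f x :> D)"

definition twice_differentiable :: "('a::euclidean_space \<Rightarrow> real) \<Rightarrow> bool"
  where "twice_differentiable f \<longleftrightarrow>
    (\<forall>x. f differentiable (at x)) \<and> (\<forall>x. grad f differentiable (at x))"

definition hessian :: "(real^'n \<Rightarrow> real) \<Rightarrow> real^'n \<Rightarrow> real^'n^'n"
  where "hessian f x = matrix (frechet_derivative (grad f) (at x))"

definition hessian_xx :: "((real^'n) \<times> (real^'m) \<Rightarrow> real) \<Rightarrow> (real^'n) \<times> (real^'m) \<Rightarrow> real^'n^'n"
  where "hessian_xx L z = hessian (\<lambda>u. L (u, snd z)) (fst z)"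

definition hessian_yy :: "((real^'n) \<times> (real^'m) \<Rightarrow> real) \<Rightarrow> (real^'n) \<times> (real^'m) \<Rightarrow> real^'m^'m"
  where "hessian_yy L z = hessian (\<lambda>v. L (fst z, v)) (snd z)"

text \<open>The Loewner order. Symmetry is not part of the definition; it is automatic for the
  matrices compared below, since second Frechet derivatives are symmetric.\<close>

definition loewner_ge :: "real^'n^'n \<Rightarrow> real^'n^'n \<Rightarrow> bool"  (infix "\<succeq>" 50)
  where "A \<succeq> B \<longleftrightarrow> (\<forall>w. w \<bullet> (B *v w) \<le> w \<bullet> (A *v w))"

text \<open>Meaningful for twice differentiable \<open>L\<close> only; \<open>\<rho>\<close> may have any sign.\<close>

definition weakly_convex_weakly_concave ::
    "real \<Rightarrow> ((real^'n) \<times> (real^'m) \<Rightarrow> real) \<Rightarrow> bool"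
  where "weakly_convex_weakly_concave \<rho> L \<longleftrightarrow>
    (\<forall>z. hessian_xx L z \<succeq> (- \<rho>) *\<^sub>R mat 1 \<and> - hessian_yy L z \<succeq> (- \<rho>) *\<^sub>R mat 1)"

text \<open>Minimum and maximum over the whole space are the least and greatest elements of the
  range. Both exist when \<open>L\<close> is twice differentiable and weakly convex-weakly concave with
  parameter less than \<open>\<eta>\<close>: the regularised objective is then strongly convex in \<open>u\<close> and
  strongly concave in \<open>v\<close>.\<close>

definition saddle_envelope ::
    "real \<Rightarrow> ((real^'n) \<times> (real^'m) \<Rightarrow> real) \<Rightarrow> (real^'n) \<times> (real^'m) \<Rightarrow> real"
  where "saddle_envelope \<eta> L z =
    (LEAST c. c \<in> range (\<lambda>u. GREATEST d. d \<in> range (\<lambda>v.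
      L (u, v) + \<eta> / 2 * (norm (u - fst z))\<^sup>2 - \<eta> / 2 * (norm (v - snd z))\<^sup>2)))"

definition has_Lipschitz_gradient :: "real \<Rightarrow> ('a::euclidean_space \<Rightarrow> real) \<Rightarrow> bool"
  where "has_Lipschitz_gradient K f \<longleftrightarrow>
    (\<forall>x. f differentiable (at x)) \<and> K-lipschitz_on UNIV (grad f)"

end

theory Submission imports Defs begin

text \<open>The saddle point \<open>w = prox z\<close> of the regularised objective solves \<open>G w = \<eta> *\<^sub>R (z - w)\<close> for
  \<open>G = (\<nabla>\<^sub>x L, - \<nabla>\<^sub>y L)\<close>; it exists because \<open>G\<close> shifted by \<open>\<eta>\<close> is continuous and strongly monotone, so
  that Brouwer's theorem yields a zero. Comparing the saddle values at two points from both sides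
  shows that the envelope has gradient \<open>\<eta> *\<^sub>R (z - prox z)\<close> up to the sign of the second component,
  and weak monotonicity of \<open>G\<close> bounds the Lipschitz constant of \<open>z - prox z\<close>.\<close>

section \<open>Zeros of strongly monotone maps\<close>

text \<open>Brouwer gives a fixed point of the projected step \<open>z - T z\<close> on a large
  ball. Strong monotonicity keeps that point away from the boundary, and at an interior point the
  projection can hide no nonzero \<open>T z\<close>.\<close>

lemma strongly_monotone_has_zero:
  fixes T :: "'a::euclidean_space \<Rightarrow> 'a"
  assumes cont: "continuous_on UNIV T" and "\<mu> > 0"
    and mono: "\<And>x y. \<mu> * (norm (x - y))\<^sup>2 \<le> (T x - T y) \<bullet> (x - y)"
  obtains z where "T z = 0"
proof -
  \<comment> \<open>The quotient is the a priori bound on the norm of the fixed point; the 1 leaves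
    room for a unit step inside the ball.\<close>
  define R where "R = norm (T 0) / \<mu> + 1"
  have "R > 0" using \<open>\<mu> > 0\<close> by (simp add: R_def add_nonneg_pos)
  define S where "S = cball (0::'a) R"
  have S: "compact S" "convex S" "closed S" "S \<noteq> {}" "0 \<in> S"
    using \<open>R > 0\<close> by (auto simp: S_def)
  have "continuous_on S (\<lambda>z. z - T z)"
    using continuous_on_subset[OF cont subset_UNIV] by (intro continuous_on_diff continuous_on_id)
  then have "continuous_on S (\<lambda>z. closest_point S (z - T z))"
    using continuous_on_compose2[OF continuous_on_closest_point[OF S(2,3,4)] _ subset_UNIV] by blast
  moreover have "(\<lambda>z. closest_point S (z - T z)) \<in> S \<rightarrow> S"
    using S by (auto intro: closest_point_in_set)
  ultimately obtain z where z: "z \<in> S" "closest_point S (z - T z) = z"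
    using brouwer[OF S(1,2,4)] by blast
  \<comment> \<open>A fixed point of the projected step has \<open>- T z\<close> in the normal cone
    of \<open>S\<close> at \<open>z\<close>: a variational inequality.\<close>
  have obtuse: "0 \<le> T z \<bullet> (x - z)" if "x \<in> S" for x
    using closest_point_dot[OF S(2,3) that, of "z - T z"] z(2) by simp
  have "\<mu> * (norm z)\<^sup>2 \<le> (T z - T 0) \<bullet> z" using mono[of z 0] by simp
  also have "\<dots> \<le> - (T 0 \<bullet> z)" using obtuse[OF S(5)] by (simp add: inner_diff_left)
  also have "\<dots> \<le> norm (T 0) * norm z"
    by (metis abs_le_D2 Cauchy_Schwarz_ineq2)
  finally have "\<mu> * norm z \<le> norm (T 0)"
    by (cases "z = 0") (auto simp: power2_eq_square algebra_simps)
  then have "norm z \<le> norm (T 0) / \<mu>" using \<open>\<mu> > 0\<close> by (simp add: field_simps)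
  then have "norm z + 1 \<le> R" by (simp add: R_def)
  have "T z = 0"
  proof (rule ccontr)
    assume "T z \<noteq> 0"
    \<comment> \<open>A unit step from \<open>z\<close> against \<open>T z\<close> stays in
      \<open>S\<close>, and testing the variational inequality there gives
      \<open>norm (T z) \<le> 0\<close>.\<close>
    define x where "x = z - (1 / norm (T z)) *\<^sub>R T z"
    have "norm x \<le> norm z + norm ((1 / norm (T z)) *\<^sub>R T z)"
      unfolding x_def by (rule norm_triangle_ineq4)
    then have "x \<in> S" using \<open>norm z + 1 \<le> R\<close> \<open>T z \<noteq> 0\<close> by (simp add: S_def)
    from obtuse[OF this] have "norm (T z) \<le> 0"
      using \<open>T z \<noteq> 0\<close> by (simp add: x_def dot_square_norm power2_eq_square)
    then show False using \<open>T z \<noteq> 0\<close> by simp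
  qed
  then show thesis by (rule that)
qed

section \<open>Gradients and quadratic lower bounds\<close>

lemma GDERIV_unique:
  fixes f :: "'a::euclidean_space \<Rightarrow> real"
  assumes "GDERIV f x :> D" "GDERIV f x :> E"
  shows "D = E"
proof -
  have "(\<lambda>h. h \<bullet> D) = (\<lambda>h. h \<bullet> E)"
    using assms unfolding gderiv_def by (rule has_derivative_unique)
  then show ?thesis by (metis vector_eq_ldot)
qed

lemma grad_eqI:
  assumes "GDERIV f x :> D"
  shows "grad f x = D"
  unfolding grad_def by (rule the_equality) (use assms GDERIV_unique in auto)

lemma GDERIV_grad:
  fixes f :: "'a::euclidean_space \<Rightarrow> real"
  assumes "f differentiable (at x)"
  shows "GDERIV f x :> grad f x"
proof -
  from assms obtain f' where f': "(f has_derivative f') (at x)"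
    by (auto simp: differentiable_def)
  have "linear f'" using f' by (rule has_derivative_linear)
  then have "(\<lambda>h. h \<bullet> adjoint f' 1) = f'"
    using adjoint_works[of f' _ 1] by (auto simp: fun_eq_iff)
  then have "GDERIV f x :> adjoint f' 1" using f' by (simp add: gderiv_def)
  then show ?thesis by (simp add: grad_eqI)
qed

text \<open>On the line through \<open>x\<close> and \<open>y\<close>, two sign arguments replace
  Taylor's formula, since \<open>g'\<close> need not be continuous: the bound makes the directional
  slope minus its linear part nondecreasing, and this makes \<open>\<phi>\<close> nondecreasing for
  nonnegative arguments. The claim is \<open>\<phi> 0 \<le> \<phi> 1\<close>.\<close>

lemma quadratic_lower_bound:
  fixes f :: "'a::euclidean_space \<Rightarrow> real"
  assumes f: "\<And>x. GDERIV f x :> g x"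
    and g: "\<And>x. (g has_derivative g' x) (at x)"
    and bound: "\<And>x w. \<kappa> * (norm w)\<^sup>2 \<le> w \<bullet> g' x w"
  shows "f x + g x \<bullet> (y - x) + \<kappa> / 2 * (norm (y - x))\<^sup>2 \<le> f y"
proof -
  define w where "w = y - x"
  have line: "((\<lambda>t. x + t *\<^sub>R w) has_derivative (\<lambda>h. h *\<^sub>R w)) (at t)" for t
    by (auto intro!: derivative_eq_intros)
  have dg: "((\<lambda>t. g (x + t *\<^sub>R w) \<bullet> w - \<kappa> * (norm w)\<^sup>2 * t) has_real_derivative
      w \<bullet> g' (x + t *\<^sub>R w) w - \<kappa> * (norm w)\<^sup>2) (at t)" for t
  proof -
    have "((\<lambda>t. g (x + t *\<^sub>R w) \<bullet> w - \<kappa> * (norm w)\<^sup>2 * t) has_derivative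
        (\<lambda>h. g' (x + t *\<^sub>R w) (h *\<^sub>R w) \<bullet> w - \<kappa> * (norm w)\<^sup>2 * h)) (at t)"
      by (intro has_derivative_diff has_derivative_inner_left has_derivative_mult_right
          has_derivative_ident has_derivative_compose[OF line g])
    moreover have "(\<lambda>h. g' (x + t *\<^sub>R w) (h *\<^sub>R w) \<bullet> w - \<kappa> * (norm w)\<^sup>2 * h)
        = (*) (w \<bullet> g' (x + t *\<^sub>R w) w - \<kappa> * (norm w)\<^sup>2)"
    proof
      fix h
      have "g' (x + t *\<^sub>R w) (h *\<^sub>R w) = h *\<^sub>R g' (x + t *\<^sub>R w) w"
        by (rule linear_scale[OF has_derivative_linear[OF g]])
      then have "g' (x + t *\<^sub>R w) (h *\<^sub>R w) \<bullet> w = (w \<bullet> g' (x + t *\<^sub>R w) w) * h"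
        by (metis inner_scaleR_left inner_commute mult.commute)
      then show "g' (x + t *\<^sub>R w) (h *\<^sub>R w) \<bullet> w - \<kappa> * (norm w)\<^sup>2 * h
          = (w \<bullet> g' (x + t *\<^sub>R w) w - \<kappa> * (norm w)\<^sup>2) * h"
        by (simp only: left_diff_distrib)
    qed
    ultimately show ?thesis by (simp only: has_field_derivative_def)
  qed
  have mono: "g x \<bullet> w \<le> g (x + t *\<^sub>R w) \<bullet> w - \<kappa> * (norm w)\<^sup>2 * t" if "0 \<le> t" for t
  proof -
    have "g (x + 0 *\<^sub>R w) \<bullet> w - \<kappa> * (norm w)\<^sup>2 * 0 \<le> g (x + t *\<^sub>R w) \<bullet> w - \<kappa> * (norm w)\<^sup>2 * t"
      by (rule DERIV_nonneg_imp_nondecreasing[OF that], intro exI conjI, rule dg) (simp add: bound)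
    then show ?thesis by simp
  qed
  define \<phi> where "\<phi> t = f (x + t *\<^sub>R w) - t * (g x \<bullet> w) - \<kappa> / 2 * (norm w)\<^sup>2 * t\<^sup>2" for t
  have d\<phi>: "(\<phi> has_real_derivative
      g (x + t *\<^sub>R w) \<bullet> w - \<kappa> * (norm w)\<^sup>2 * t - g x \<bullet> w) (at t)" for t
  proof -
    have "((\<lambda>t. f (x + t *\<^sub>R w)) has_derivative (\<lambda>h. (h *\<^sub>R w) \<bullet> g (x + t *\<^sub>R w))) (at t)"
      by (rule has_derivative_compose[OF line f[unfolded gderiv_def]])
    then have "((\<lambda>t. f (x + t *\<^sub>R w)) has_real_derivative g (x + t *\<^sub>R w) \<bullet> w) (at t)"
      by (simp only: has_field_derivative_def inner_scaleR_left mult_commute_abs inner_commute)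
    then show ?thesis
      unfolding \<phi>_def by (auto intro!: derivative_eq_intros)
  qed
  have "0 \<le> g (x + t *\<^sub>R w) \<bullet> w - \<kappa> * (norm w)\<^sup>2 * t - g x \<bullet> w" if "0 \<le> t" for t
    using mono[OF that] by simp
  then have nonneg: "\<exists>D. (\<phi> has_real_derivative D) (at t) \<and> 0 \<le> D" if "0 \<le> t" for t
    using d\<phi> that by blast
  have "\<phi> 0 \<le> \<phi> 1"
    by (rule DERIV_nonneg_imp_nondecreasing) (simp_all add: nonneg)
  then show ?thesis by (simp add: \<phi>_def w_def)
qed

section \<open>The saddle envelope\<close>

text \<open>\<open>P\<close> and \<open>Q\<close> stand for the partial gradients of
  \<open>L\<close>. Curvature enters only through the two quadratic inequalities, so second
  derivatives do not appear below.\<close>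

locale saddle_problem =
  fixes L :: "'a::euclidean_space \<times> 'b::euclidean_space \<Rightarrow> real"
    and P :: "'a \<times> 'b \<Rightarrow> 'a" and Q :: "'a \<times> 'b \<Rightarrow> 'b"
    and \<eta> \<rho> :: real
  assumes cont_P: "continuous_on UNIV P" and cont_Q: "continuous_on UNIV Q"
    and lower: "\<And>u u' v. L (u, v) + P (u, v) \<bullet> (u' - u) - \<rho> / 2 * (norm (u' - u))\<^sup>2 \<le> L (u', v)"
    and upper: "\<And>u v v'. L (u, v') \<le> L (u, v) + Q (u, v) \<bullet> (v' - v) + \<rho> / 2 * (norm (v' - v))\<^sup>2"
    and \<eta>_pos: "\<eta> > 0" and \<eta>_gt: "\<eta> > \<rho>"
begin

section \<open>Saddle points of the regularised objective\<close>

definition reg :: "'a \<times> 'b \<Rightarrow> 'a \<Rightarrow> 'b \<Rightarrow> real"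
  where "reg z u v = L (u, v) + \<eta> / 2 * (norm (u - fst z))\<^sup>2 - \<eta> / 2 * (norm (v - snd z))\<^sup>2"

definition G :: "'a \<times> 'b \<Rightarrow> 'a \<times> 'b"
  where "G w = (P w, - Q w)"

text \<open>The four inequalities run around the rectangle with corners \<open>(u, v)\<close>,
  \<open>(u', v)\<close>, \<open>(u', v')\<close>, \<open>(u, v')\<close>. In their sum all values
  of \<open>L\<close> cancel, and the halves of \<open>\<rho>\<close> add up in each
  variable.\<close>

lemma G_weakly_monotone: "- \<rho> * (norm (w - w'))\<^sup>2 \<le> (G w - G w') \<bullet> (w - w')"
proof -
  obtain u v u' v' where w: "w = (u, v)" "w' = (u', v')" by fastforce
  have "L (u, v) + P (u, v) \<bullet> (u' - u) - \<rho> / 2 * (norm (u' - u))\<^sup>2 \<le> L (u', v)"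
    "L (u', v') + P (u', v') \<bullet> (u - u') - \<rho> / 2 * (norm (u - u'))\<^sup>2 \<le> L (u, v')"
    "L (u, v') \<le> L (u, v) + Q (u, v) \<bullet> (v' - v) + \<rho> / 2 * (norm (v' - v))\<^sup>2"
    "L (u', v) \<le> L (u', v') + Q (u', v') \<bullet> (v - v') + \<rho> / 2 * (norm (v - v'))\<^sup>2"
    by (rule lower upper)+
  moreover have "(norm (w - w'))\<^sup>2 = (norm (u - u'))\<^sup>2 + (norm (v - v'))\<^sup>2"
    by (simp add: w norm_Pair)
  ultimately show ?thesis
    by (simp add: w G_def norm_minus_commute[of u'] norm_minus_commute[of v']
        inner_diff_left inner_diff_right algebra_simps)
qed

lemma saddle_point_exists: "\<exists>w. G w = \<eta> *\<^sub>R (z - w)"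
proof -
  define T where "T w = G w + \<eta> *\<^sub>R (w - z)" for w
  have "continuous_on UNIV T"
    unfolding T_def G_def by (intro continuous_intros cont_P cont_Q)
  moreover have "(\<eta> - \<rho>) * (norm (w - w'))\<^sup>2 \<le> (T w - T w') \<bullet> (w - w')" for w w'
  proof -
    have "T w - T w' = G w - G w' + \<eta> *\<^sub>R (w - w')" by (simp add: T_def algebra_simps)
    then show ?thesis
      using G_weakly_monotone[of w w']
      by (simp add: inner_add_left dot_square_norm left_diff_distrib)
  qed
  ultimately obtain w where "T w = 0"
    using strongly_monotone_has_zero[of T "\<eta> - \<rho>"] \<eta>_gt
    by (metis diff_gt_0_iff_gt)
  then have "G w = \<eta> *\<^sub>R (z - w)" by (simp add: T_def algebra_simps add_eq_0_iff2)
  then show ?thesis ..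
qed

text \<open>The hypothesis is stationarity in \<open>u\<close>. Expanding the square about
  \<open>u\<close> cancels the first-order term, and \<open>\<eta> > \<rho>\<close> lets the
  remaining square absorb the weak convexity defect, so the stationary point is a global minimiser.
  \<open>reg_le\<close> is the mirror image in \<open>v\<close>.\<close>

lemma reg_ge:
  assumes "P (u, v) = \<eta> *\<^sub>R (fst z - u)"
  shows "reg z u v \<le> reg z u' v"
proof -
  have "(norm (u' - fst z))\<^sup>2 = (norm (u - fst z))\<^sup>2 - 2 * ((fst z - u) \<bullet> (u' - u)) + (norm (u' - u))\<^sup>2"
    by (simp add: power2_norm_eq_inner inner_diff_left inner_diff_right inner_commute)
  then have "reg z u' v - reg z u v
      = L (u', v) - L (u, v) - P (u, v) \<bullet> (u' - u) + \<eta> / 2 * (norm (u' - u))\<^sup>2"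
    by (simp only: reg_def assms inner_scaleR_left) (simp add: field_simps)
  moreover have "\<rho> / 2 * (norm (u' - u))\<^sup>2 \<le> \<eta> / 2 * (norm (u' - u))\<^sup>2"
    using \<eta>_gt by (intro mult_right_mono) auto
  ultimately show ?thesis using lower[of u v u'] by simp
qed

lemma reg_le:
  assumes "Q (u, v) = \<eta> *\<^sub>R (v - snd z)"
  shows "reg z u v' \<le> reg z u v"
proof -
  have "(norm (v' - snd z))\<^sup>2 = (norm (v - snd z))\<^sup>2 + 2 * ((v - snd z) \<bullet> (v' - v)) + (norm (v' - v))\<^sup>2"
    by (simp add: power2_norm_eq_inner inner_diff_left inner_diff_right inner_commute)
  then have "reg z u v' - reg z u v
      = L (u, v') - L (u, v) - Q (u, v) \<bullet> (v' - v) - \<eta> / 2 * (norm (v' - v))\<^sup>2"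
    by (simp only: reg_def assms inner_scaleR_left) (simp add: field_simps)
  moreover have "\<rho> / 2 * (norm (v' - v))\<^sup>2 \<le> \<eta> / 2 * (norm (v' - v))\<^sup>2"
    using \<eta>_gt by (intro mult_right_mono) auto
  ultimately show ?thesis using upper[of u v' v] by simp
qed

text \<open>The outer minimum compares all \<open>u\<close>, so the inner maximum must be attained
  for every \<open>u\<close>, not only at the saddle point; otherwise \<open>GREATEST\<close> would
  carry no information.\<close>

lemma inner_maximum_exists: "\<exists>v. \<forall>v'. reg z u v' \<le> reg z u v"
proof -
  define T where "T v = \<eta> *\<^sub>R (v - snd z) - Q (u, v)" for v
  have "continuous_on UNIV T"
    unfolding T_def
    by (intro continuous_intros continuous_on_compose2[OF cont_Q]) auto
  moreover have "(\<eta> - \<rho>) * (norm (v - v'))\<^sup>2 \<le> (T v - T v') \<bullet> (v - v')" for v v'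
  proof -
    have "T v - T v' = \<eta> *\<^sub>R (v - v') - (Q (u, v) - Q (u, v'))"
      by (simp add: T_def algebra_simps)
    \<comment> \<open>For two points with equal first coordinates, weak monotonicity of
      \<open>G\<close> concerns \<open>- Q\<close> alone.\<close>
    then show ?thesis
      using G_weakly_monotone[of "(u, v)" "(u, v')"]
      by (simp add: G_def norm_Pair inner_diff_left dot_square_norm left_diff_distrib)
  qed
  ultimately obtain v where "T v = 0"
    using strongly_monotone_has_zero[of T "\<eta> - \<rho>"] \<eta>_gt
    by (metis diff_gt_0_iff_gt)
  then show ?thesis using reg_le[of u v z] by (auto simp: T_def)
qed

section \<open>The proximal map and the value of the envelope\<close>

text \<open>This is the resolvent of \<open>G\<close>: the equation says that \<open>w\<close> plus
  \<open>G w\<close> divided by \<open>\<eta>\<close> equals \<open>z\<close>.\<close>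

definition prox :: "'a \<times> 'b \<Rightarrow> 'a \<times> 'b"
  where "prox z = (SOME w. G w = \<eta> *\<^sub>R (z - w))"

definition envelope :: "'a \<times> 'b \<Rightarrow> real"
  where "envelope z = (LEAST c. c \<in> range (\<lambda>u. GREATEST d. d \<in> range (reg z u)))"

lemma G_prox: "G (prox z) = \<eta> *\<^sub>R (z - prox z)"
  unfolding prox_def using saddle_point_exists by (rule someI_ex)

lemma prox_saddle:
  "reg z (fst (prox z)) v \<le> reg z (fst (prox z)) (snd (prox z))"
  "reg z (fst (prox z)) (snd (prox z)) \<le> reg z u (snd (prox z))"
proof -
  have "P (prox z) = \<eta> *\<^sub>R (fst z - fst (prox z))" "- Q (prox z) = \<eta> *\<^sub>R (snd z - snd (prox z))"
    using G_prox[of z] by (auto simp: G_def prod_eq_iff)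
  moreover from this(2) have "Q (prox z) = \<eta> *\<^sub>R (snd (prox z) - snd z)"
    by (metis minus_diff_eq minus_equation_iff scaleR_minus_right)
  ultimately show "reg z (fst (prox z)) v \<le> reg z (fst (prox z)) (snd (prox z))"
    "reg z (fst (prox z)) (snd (prox z)) \<le> reg z u (snd (prox z))"
    by (auto intro: reg_le reg_ge)
qed

text \<open>For any \<open>u\<close> the inner maximum is at least the value at
  \<open>snd (prox z)\<close>, which is at least the saddle value. At
  \<open>u = fst (prox z)\<close> the inner maximum is the saddle value itself, so the outer minimum
  is attained there.\<close>

lemma envelope_eq: "envelope z = reg z (fst (prox z)) (snd (prox z))"
proof -
  have greatest: "(GREATEST d. d \<in> range (reg z u)) = reg z u v"
    if "\<And>v'. reg z u v' \<le> reg z u v" for u v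
    using that by (intro Greatest_equality) auto
  have "reg z (fst (prox z)) (snd (prox z)) \<le> (GREATEST d. d \<in> range (reg z u))" for u
  proof -
    obtain v where v: "\<And>v'. reg z u v' \<le> reg z u v" using inner_maximum_exists by blast
    have "reg z (fst (prox z)) (snd (prox z)) \<le> reg z u v"
      using prox_saddle(2) v by (rule order_trans)
    then show ?thesis by (simp add: greatest[OF v])
  qed
  moreover have "reg z (fst (prox z)) (snd (prox z))
      \<in> range (\<lambda>u. GREATEST d. d \<in> range (reg z u))"
    by (rule range_eqI[where x = "fst (prox z)"], rule greatest[symmetric], rule prox_saddle)
  ultimately show ?thesis unfolding envelope_def by (intro Least_equality) auto
qed

section \<open>Lipschitz bound for the candidate gradient\<close>

text \<open>The gradient predicted by the envelope theorem: differentiate \<open>reg z u v\<close>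
  in \<open>z\<close> with \<open>(u, v)\<close> frozen at \<open>prox z\<close>.\<close>

definition slope :: "'a \<times> 'b \<Rightarrow> 'a \<times> 'b"
  where "slope z = (\<eta> *\<^sub>R (fst z - fst (prox z)), \<eta> *\<^sub>R (snd (prox z) - snd z))"

abbreviation K :: real where "K \<equiv> max \<eta> \<bar>\<eta> * \<rho> / (\<eta> - \<rho>)\<bar>"

text \<open>Weak monotonicity of \<open>G\<close> says that \<open>h\<close> lies in the ball having the segment from
  \<open>- \<rho> / (\<eta> - \<rho>) *\<^sub>R d\<close> to \<open>d\<close> as a diameter.\<close>

lemma norm_prox_residual_diff_le:
  "\<eta> * norm ((z - prox z) - (z' - prox z')) \<le> K * norm (z - z')"
proof -
  define h where "h = (z - prox z) - (z' - prox z')"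
  define d where "d = z - z'"
  \<comment> \<open>With this ratio, \<open>K\<close> equals
    \<open>\<eta> * max 1 \<bar>s\<bar>\<close>, so it remains to bound \<open>norm h\<close> by
    \<open>max 1 \<bar>s\<bar> * norm d\<close>.\<close>
  define s where "s = \<rho> / (\<eta> - \<rho>)"
  have "prox z - prox z' = d - h" "G (prox z) - G (prox z') = \<eta> *\<^sub>R h"
    by (auto simp: h_def d_def G_prox algebra_simps)
  then have "- \<rho> * (norm (d - h))\<^sup>2 \<le> \<eta> * (h \<bullet> (d - h))"
    using G_weakly_monotone[of "prox z" "prox z'"] by simp
  then have "(h - d) \<bullet> ((\<eta> - \<rho>) *\<^sub>R h + \<rho> *\<^sub>R d) \<le> 0"
    by (simp add: power2_norm_eq_inner algebra_simps inner_commute)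
  also have "(\<eta> - \<rho>) *\<^sub>R h + \<rho> *\<^sub>R d = (\<eta> - \<rho>) *\<^sub>R (h + s *\<^sub>R d)"
    using \<eta>_gt by (simp add: s_def scaleR_add_right)
  finally have ball: "(h - d) \<bullet> (h + s *\<^sub>R d) \<le> 0"
    using \<eta>_gt by (simp add: mult_le_0_iff)
  have "(norm h)\<^sup>2 \<le> (1 - s) * (h \<bullet> d) + s * (norm d)\<^sup>2"
    using ball by (simp add: power2_norm_eq_inner algebra_simps inner_commute)
  also have "\<dots> \<le> \<bar>1 - s\<bar> * (norm h * norm d) + s * (norm d)\<^sup>2"
  proof -
    have "(1 - s) * (h \<bullet> d) \<le> \<bar>1 - s\<bar> * \<bar>h \<bullet> d\<bar>" by (metis abs_ge_self abs_mult)
    also have "\<dots> \<le> \<bar>1 - s\<bar> * (norm h * norm d)"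
      by (intro mult_left_mono Cauchy_Schwarz_ineq2) auto
    finally show ?thesis by simp
  qed
  finally have quad: "(norm h)\<^sup>2 \<le> \<bar>1 - s\<bar> * (norm h * norm d) + s * (norm d)\<^sup>2" .
  have "norm h \<le> max 1 \<bar>s\<bar> * norm d"
  proof (rule ccontr)
    assume "\<not> ?thesis"
    then have "max 1 \<bar>s\<bar> * norm d < norm h" by simp
    moreover have "1 * norm d \<le> max 1 \<bar>s\<bar> * norm d" "\<bar>s\<bar> * norm d \<le> max 1 \<bar>s\<bar> * norm d"
      by (intro mult_right_mono; simp)+
    ultimately have big: "norm d < norm h" "\<bar>s\<bar> * norm d < norm h" by auto
    moreover have "- (s * norm d) \<le> \<bar>s\<bar> * norm d" "s * norm d \<le> \<bar>s\<bar> * norm d"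
      using mult_right_mono[of "- s" "\<bar>s\<bar>" "norm d"] mult_right_mono[of s "\<bar>s\<bar>" "norm d"] by auto
    ultimately have "0 < norm h + s * norm d" "0 < norm h - s * norm d" by linarith+
    \<comment> \<open>These products are the two factorisations of the quadratic in
      \<open>quad\<close> with all terms on one side: the first when \<open>s \<le> 1\<close>, the
      second when \<open>s > 1\<close>. Positivity contradicts \<open>quad\<close> in either
      case.\<close>
    then have "0 < (norm h - norm d) * (norm h + s * norm d)"
      "0 < (norm h - s * norm d) * (norm h + norm d)"
      using big by (auto intro!: mult_pos_pos add_pos_nonneg le_less_trans[OF norm_ge_zero big(1)])
    then show False using quad
      by (cases "s \<le> 1") (auto simp: power2_eq_square algebra_simps)
  qed
  then have "\<eta> * norm h \<le> \<eta> * (max 1 \<bar>s\<bar> * norm d)" using \<eta>_pos by simp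
  also have "\<dots> = K * norm d"
    using \<eta>_pos by (simp add: s_def abs_mult max_mult_distrib_left mult.assoc[symmetric] abs_divide)
  finally show ?thesis by (simp add: h_def d_def)
qed

text \<open>\<open>slope z\<close> is \<open>\<eta> *\<^sub>R (z - prox z)\<close> with its second
  component negated, which preserves norms of differences.\<close>

lemma norm_slope_diff_le: "norm (slope z - slope z') \<le> K * norm (z - z')"
proof -
  have "norm (slope z - slope z')
      = norm (\<eta> *\<^sub>R ((z - prox z) - (z' - prox z')))"
  proof -
    have "snd (slope z - slope z') = - snd (\<eta> *\<^sub>R ((z - prox z) - (z' - prox z')))"
      "fst (slope z - slope z') = fst (\<eta> *\<^sub>R ((z - prox z) - (z' - prox z')))"
      by (auto simp: slope_def algebra_simps)
    then show ?thesis by (simp only: norm_prod_def norm_minus_cancel)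
  qed
  then show ?thesis using norm_prox_residual_diff_le[of z z'] \<eta>_pos by simp
qed

section \<open>Differentiability of the envelope\<close>

text \<open>Testing each of the two saddle points against the other one's coordinates bounds the
  increment of the envelope on both sides.\<close>

lemma envelope_expansion:
  "\<bar>envelope z' - envelope z - slope z \<bullet> (z' - z)\<bar>
    \<le> (norm (slope z' - slope z) + \<eta> / 2 * norm (z' - z)) * norm (z' - z)"
proof -
  obtain x y x' y' where z: "z = (x, y)" "z' = (x', y')" by fastforce
  obtain u v u' v' where w: "prox z = (u, v)" "prox z' = (u', v')" by fastforce
  define k where "k = \<eta> / 2"
  have k: "\<eta> = 2 * k" by (simp add: k_def)
  have slopes: "slope z = (\<eta> *\<^sub>R (x - u), \<eta> *\<^sub>R (v - y))" "slope z' = (\<eta> *\<^sub>R (x' - u'), \<eta> *\<^sub>R (v' - y'))"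
    unfolding slope_def w by (simp_all add: z)
  define \<Delta> where "\<Delta> = slope z' - slope z"
  have bound: "\<bar>fst \<Delta> \<bullet> (x' - x)\<bar> \<le> norm \<Delta> * norm (z' - z)"
    "\<bar>snd \<Delta> \<bullet> (y' - y)\<bar> \<le> norm \<Delta> * norm (z' - z)"
    using norm_fst_le[of "fst \<Delta>" "snd \<Delta>"] norm_snd_le[of "snd \<Delta>" "fst \<Delta>"]
      norm_fst_le[of "x' - x" "y' - y"] norm_snd_le[of "y' - y" "x' - x"]
    by (auto intro!: order_trans[OF Cauchy_Schwarz_ineq2] mult_mono simp: z)
  have sq: "(norm (z' - z))\<^sup>2 = (norm (x' - x))\<^sup>2 + (norm (y' - y))\<^sup>2"
    by (simp add: z norm_Pair)
  have "envelope z' - envelope z \<le> reg z' u v' - reg z u v'"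
    using prox_saddle(2)[of z' u] prox_saddle(1)[of z v'] by (simp add: envelope_eq w)
  \<comment> \<open>At the mixed point \<open>(u, v')\<close> the values of \<open>L\<close> cancel.
    Expanding the first square about \<open>z\<close> and the second about \<open>z'\<close> gives
    both quadratic remainders a plus sign; the second expansion yields the slope at
    \<open>z'\<close>, whence \<open>snd \<Delta>\<close>.\<close>
  also have "\<dots> = slope z \<bullet> (z' - z) + \<eta> / 2 * (norm (z' - z))\<^sup>2 + snd \<Delta> \<bullet> (y' - y)"
    unfolding sq \<Delta>_def slopes reg_def unfolding z fst_conv snd_conv unfolding k
    by (simp add: power2_norm_eq_inner inner_diff_left inner_diff_right inner_commute right_diff_distrib
        distrib_left mult.assoc)
  finally have up: "envelope z' - envelope z - slope z \<bullet> (z' - z)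
      \<le> \<eta> / 2 * (norm (z' - z))\<^sup>2 + snd \<Delta> \<bullet> (y' - y)" by simp
  \<comment> \<open>The opposite mixed point \<open>(u', v)\<close> exchanges the two expansions:
    both remainders turn negative and the error is \<open>fst \<Delta>\<close>.\<close>
  have "slope z \<bullet> (z' - z) - \<eta> / 2 * (norm (z' - z))\<^sup>2 + fst \<Delta> \<bullet> (x' - x)
      = reg z' u' v - reg z u' v"
    unfolding sq \<Delta>_def slopes reg_def unfolding z fst_conv snd_conv unfolding k
    by (simp add: power2_norm_eq_inner inner_diff_left inner_diff_right inner_commute right_diff_distrib
        distrib_left mult.assoc)
  also have "\<dots> \<le> envelope z' - envelope z"
    using prox_saddle(1)[of z' v] prox_saddle(2)[of z u'] by (simp add: envelope_eq w)
  finally have "fst \<Delta> \<bullet> (x' - x) - \<eta> / 2 * (norm (z' - z))\<^sup>2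
      \<le> envelope z' - envelope z - slope z \<bullet> (z' - z)" by simp
  then have "\<bar>envelope z' - envelope z - slope z \<bullet> (z' - z)\<bar>
      \<le> norm \<Delta> * norm (z' - z) + \<eta> / 2 * (norm (z' - z))\<^sup>2"
    using up bound by linarith
  then show ?thesis by (simp add: \<Delta>_def power2_eq_square algebra_simps)
qed

text \<open>The Lipschitz bound on \<open>slope\<close> makes the error in
  \<open>envelope_expansion\<close> quadratic in \<open>norm (z' - z)\<close>, which gives Frechet
  differentiability.\<close>

lemma GDERIV_envelope: "GDERIV envelope z :> slope z"
proof -
  define C where "C = K + \<eta> / 2"
  have "C > 0" using \<eta>_pos by (simp add: C_def add_pos_pos less_max_iff_disj)
  have quad: "\<bar>envelope z' - envelope z - (z' - z) \<bullet> slope z\<bar> \<le> C * norm (z' - z) * norm (z' - z)" for z'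
  proof -
    have "norm (slope z' - slope z) + \<eta> / 2 * norm (z' - z) \<le> C * norm (z' - z)"
      using norm_slope_diff_le[of z' z] by (simp add: C_def distrib_right)
    then show ?thesis
      unfolding inner_commute[of "z' - z"]
      by (intro order_trans[OF envelope_expansion mult_right_mono]) auto
  qed
  have "(envelope has_derivative (\<lambda>h. h \<bullet> slope z)) (at z)"
    unfolding has_derivative_at_alt
  proof (intro conjI allI impI bounded_linear_inner_left)
    fix e :: real assume "e > 0"
    have "norm (envelope z' - envelope z - (z' - z) \<bullet> slope z) \<le> e * norm (z' - z)"
      if "norm (z' - z) < e / C" for z'
    proof -
      have "C * norm (z' - z) \<le> e" using that \<open>C > 0\<close> by (simp add: field_simps)
      then have "C * norm (z' - z) * norm (z' - z) \<le> e * norm (z' - z)"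
        by (rule mult_right_mono) simp
      then show ?thesis using quad[of z'] by simp
    qed
    then show "\<exists>d>0. \<forall>z'. norm (z' - z) < d \<longrightarrow>
        norm (envelope z' - envelope z - (z' - z) \<bullet> slope z) \<le> e * norm (z' - z)"
      using \<open>e > 0\<close> \<open>C > 0\<close> by (intro exI[of _ "e / C"]) auto
  qed
  then show ?thesis by (simp add: gderiv_def)
qed

lemma has_Lipschitz_gradient_envelope: "has_Lipschitz_gradient K envelope"
proof -
  have "grad envelope = slope" by (auto intro!: grad_eqI GDERIV_envelope)
  moreover have "envelope differentiable (at z)" for z
    using GDERIV_envelope[of z] by (auto simp: gderiv_def differentiable_def)
  moreover have "K-lipschitz_on UNIV slope"
    using norm_slope_diff_le \<eta>_pos by (auto intro!: lipschitz_onI simp: dist_norm)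
  ultimately show ?thesis by (simp add: has_Lipschitz_gradient_def)
qed

end

section \<open>Hessian bounds\<close>

lemma has_derivative_slice_fst:
  assumes "(f has_derivative f') (at (u, v))"
  shows "((\<lambda>u. f (u, v)) has_derivative (\<lambda>h. f' (h, 0))) (at u)"
  by (rule has_derivative_compose[of "\<lambda>u. (u, v)" "\<lambda>h. (h, 0)" u UNIV f f'])
     (use assms in \<open>auto intro!: derivative_eq_intros\<close>)

lemma has_derivative_slice_snd:
  assumes "(f has_derivative f') (at (u, v))"
  shows "((\<lambda>v. f (u, v)) has_derivative (\<lambda>h. f' (0, h))) (at v)"
  by (rule has_derivative_compose[of "\<lambda>v. (u, v)" "\<lambda>h. (0, h)" v UNIV f f'])
     (use assms in \<open>auto intro!: derivative_eq_intros\<close>)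

text \<open>Replaces the choice-based \<open>grad\<close> and \<open>frechet_derivative\<close>
  inside \<open>hessian\<close> by an explicit derivative.\<close>

lemma hessian_mult:
  fixes f :: "real^'n \<Rightarrow> real"
  assumes "\<And>x. GDERIV f x :> g x" and "(g has_derivative g') (at x)"
  shows "hessian f x *v w = g' w"
proof -
  have "grad f = g" using assms(1) by (auto intro: grad_eqI)
  then show ?thesis
    using frechet_derivative_at[OF assms(2)] has_derivative_linear[OF assms(2)]
    by (simp add: hessian_def matrix_works)
qed

lemma loewner_ge_scaled_identityD:
  assumes "A \<succeq> c *\<^sub>R mat 1"
  shows "c * (norm w)\<^sup>2 \<le> w \<bullet> (A *v w)"
  using assms unfolding loewner_ge_def
  by (metis scaleR_matrix_vector_assoc matrix_vector_mul_lid inner_scaleR_right power2_norm_eq_inner)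

section \<open>From Hessian bounds to the saddle problem\<close>

theorem proposition2p9:
  fixes L :: "(real^'n) \<times> (real^'m) \<Rightarrow> real" and \<eta> \<rho> :: real
  assumes "twice_differentiable L"
    and "weakly_convex_weakly_concave \<rho> L"
    and "\<eta> > 0" and "\<eta> > \<rho>"
  shows "has_Lipschitz_gradient (max \<eta> \<bar>\<eta> * \<rho> / (\<eta> - \<rho>)\<bar>) (saddle_envelope \<eta> L)"
proof -
  define H where "H z = frechet_derivative (grad L) (at z)" for z
  have dL: "(L has_derivative (\<lambda>h. h \<bullet> grad L z)) (at z)" for z
    using assms(1) GDERIV_grad[of L z] unfolding twice_differentiable_def gderiv_def by blast
  have dG: "(grad L has_derivative H z) (at z)" for z
    using assms(1) unfolding twice_differentiable_def H_def frechet_derivative_works by blast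
  have cont: "continuous_on UNIV (grad L)"
    using dG by (intro continuous_at_imp_continuous_on ballI) (rule has_derivative_continuous)
  \<comment> \<open>Slicing a variable selects a component of the full gradient, and differentiating
    again selects a diagonal block of \<open>H\<close>. The Hessian hypotheses bound exactly these
    blocks.\<close>
  have x1: "GDERIV (\<lambda>u. L (u, v)) u :> fst (grad L (u, v))" for u v
    using has_derivative_slice_fst[OF dL] by (simp add: gderiv_def inner_prod_def)
  have x2: "((\<lambda>u. fst (grad L (u, v))) has_derivative (\<lambda>h. fst (H (u, v) (h, 0)))) (at u)" for u v
    by (rule has_derivative_fst[OF has_derivative_slice_fst[OF dG]])
  have y1: "GDERIV (\<lambda>v. L (u, v)) v :> snd (grad L (u, v))" for u v
    using has_derivative_slice_snd[OF dL] by (simp add: gderiv_def inner_prod_def)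
  have y2: "((\<lambda>v. snd (grad L (u, v))) has_derivative (\<lambda>h. snd (H (u, v) (0, h)))) (at v)" for u v
    by (rule has_derivative_snd[OF has_derivative_slice_snd[OF dG]])

  have hx: "- \<rho> * (norm w)\<^sup>2 \<le> w \<bullet> fst (H (u, v) (w, 0))" for u v w
  proof -
    have "hessian_xx L (u, v) \<succeq> (- \<rho>) *\<^sub>R mat 1"
      using assms(2) by (simp add: weakly_convex_weakly_concave_def)
    from loewner_ge_scaled_identityD[OF this] show ?thesis
      by (simp add: hessian_xx_def hessian_mult[OF x1 x2])
  qed
  have hy: "- \<rho> * (norm w)\<^sup>2 \<le> w \<bullet> - snd (H (u, v) (0, w))" for u v w
  proof -
    have "- hessian_yy L (u, v) \<succeq> (- \<rho>) *\<^sub>R mat 1"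
      using assms(2) by (simp add: weakly_convex_weakly_concave_def)
    from loewner_ge_scaled_identityD[OF this] show ?thesis
      by (simp add: hessian_yy_def hessian_mult[OF y1 y2] matrix_vector_mult_diff_rdistrib[of 0, simplified])
  qed

  interpret saddle_problem L "\<lambda>z. fst (grad L z)" "\<lambda>z. snd (grad L z)" \<eta> \<rho>
  proof
    fix u u' v v'
    have "L (u, v) + fst (grad L (u, v)) \<bullet> (u' - u) + - \<rho> / 2 * (norm (u' - u))\<^sup>2 \<le> L (u', v)"
      by (rule quadratic_lower_bound[OF x1 x2 hx])
    then show "L (u, v) + fst (grad L (u, v)) \<bullet> (u' - u) - \<rho> / 2 * (norm (u' - u))\<^sup>2 \<le> L (u', v)"
      by simp
    \<comment> \<open>The upper bound in \<open>v\<close> is the quadratic lower bound for the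
      negated slice.\<close>
    have "- L (u, v) + - snd (grad L (u, v)) \<bullet> (v' - v) + - \<rho> / 2 * (norm (v' - v))\<^sup>2 \<le> - L (u, v')"
      by (rule quadratic_lower_bound[OF GDERIV_minus[OF y1] has_derivative_minus[OF y2] hy])
    then show "L (u, v') \<le> L (u, v) + snd (grad L (u, v)) \<bullet> (v' - v) + \<rho> / 2 * (norm (v' - v))\<^sup>2"
      by simp
  qed (use assms cont in \<open>auto intro: continuous_intros\<close>)

  have "saddle_envelope \<eta> L = envelope"
    by (simp add: fun_eq_iff saddle_envelope_def envelope_def reg_def)
  then show ?thesis using has_Lipschitz_gradient_envelope by simp
qed

end
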